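(* Let $n\ge 1$ be an integer, let $x_0,\dots,x_n\in\mathbb{R}$, and let $$\mu=\frac1{n+1}\sum_{i=0}^n x_i,\qquad \sigma^2=\frac1{n+1}\sum_{i=0}^n (x_i-\mu)^2\quad(\sigma\ge 0).$$ With $L_n(\sigma)$ and $M_n(\sigma)$ as defined in the context, $$e^{\mu}L_n(\sigma)\ \le\ n!\,\exp[x_0,\dots,x_n]\ \le\ e^{\mu}M_n(\sigma).$$ Moreover, within the class of vectors in $\mathbb{R}^{n+1}$ with mean $\mu$ and variance $\sigma^2$, both inequalities are sharp: with $a_0=\sqrt{n}\,\sigma$, equality on the right holds for the configuration $(\mu+a_0,\ \mu-a_0/n,\dots,\mu-a_0/n)$ (up to permutation), and equality on the left holds for the configuration $(\mu-a_0,\ \mu+a_0/n,\dots,\mu+a_0/n)$ (up to permutation).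
   Context: $\exp[z_0,\dots,z_m]$ denotes the divided difference of the function $e^x$ at the nodes $z_0,\dots,z_m$. It is symmetric in the nodes; for pairwise distinct nodes it equals $\sum_{i=0}^m e^{z_i}/\prod_{j\ne i}(z_i-z_j)$, and for repeated nodes it is defined by continuous extension, equivalently by the contour integral $\frac{1}{2\pi i}\oint_\Gamma \frac{e^z}{\prod_{i=0}^m (z-z_i)}\,dz$ with $\Gamma$ a positively oriented contour enclosing all nodes. The lower incomplete gamma function is $\gamma(n,z)=\int_0^z t^{n-1}e^{-t}\,dt$ for integer $n\ge1$ and real $z$ (possibly negative). For $\sigma>0$, with $a_0:=\sqrt{n}\,\sigma$ and $a:=\frac{n+1}{\sqrt n}\,\sigma$, $$L_n(\sigma):=n\,e^{-a_0}\,(-a)^{-n}\,\gamma(n,-a),\qquad M_n(\sigma):=n\,e^{a_0}\,a^{-n}\,\gamma(n,a),$$ and for $\sigma=0$ these are understood by their limits, $L_n(0)=M_n(0)=1$. *)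

theory Defs
  imports "HOL-Analysis.Analysis"
begin

text \<open>
  Nodes are given as a function on the indices \<open>0, \<dots>, n\<close>; values at larger indices are irrelevant.
\<close>

definition divdiff_distinct :: "(real \<Rightarrow> real) \<Rightarrow> nat \<Rightarrow> (nat \<Rightarrow> real) \<Rightarrow> real" where
  "divdiff_distinct f n x = (\<Sum>i\<le>n. f (x i) / (\<Prod>j\<in>{..n} - {i}. x i - x j))"

text \<open>
  If some nodes coincide, the divided difference is the limit along pairwise distinct nodes tending
  to the given ones. The limit is taken in the product topology on \<^typ>\<open>nat \<Rightarrow> real\<close>; as
  \<^const>\<open>divdiff_distinct\<close> only looks at the first \<open>n + 1\<close> coordinates, this
  amounts to convergence in the Euclidean space of dimension \<open>n + 1\<close>.
\<close>

definition divdiff :: "(real \<Rightarrow> real) \<Rightarrow> nat \<Rightarrow> (nat \<Rightarrow> real) \<Rightarrow> real" where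
  "divdiff f n x =
     (if inj_on x {..n} then divdiff_distinct f n x
      else Lim (at x within {y. inj_on y {..n}}) (divdiff_distinct f n))"

definition mean :: "nat \<Rightarrow> (nat \<Rightarrow> real) \<Rightarrow> real" where
  "mean n x = 1 / real (n + 1) * (\<Sum>i\<le>n. x i)"

definition var :: "nat \<Rightarrow> (nat \<Rightarrow> real) \<Rightarrow> real" where
  "var n x = 1 / real (n + 1) * (\<Sum>i\<le>n. (x i - mean n x)\<^sup>2)"

text \<open>The interval integral is signed, so negative \<open>z\<close> is covered.\<close>

definition lower_gamma :: "nat \<Rightarrow> real \<Rightarrow> real" where
  "lower_gamma n z = (LBINT t=ereal 0..ereal z. t ^ (n - 1) * exp (- t))"

text \<open>
  At \<open>\<sigma> = 0\<close> the two expressions below have the form \<open>0 / 0\<close>;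
  their value there is the limit \<open>1\<close>.
\<close>

definition L_bound :: "nat \<Rightarrow> real \<Rightarrow> real" where
  "L_bound n \<sigma> =
     (if \<sigma> = 0 then 1
      else let a0 = sqrt (real n) * \<sigma>; a = real (n + 1) / sqrt (real n) * \<sigma>
           in real n * exp (- a0) * (- a) powi (- int n) * lower_gamma n (- a))"

definition M_bound :: "nat \<Rightarrow> real \<Rightarrow> real" where
  "M_bound n \<sigma> =
     (if \<sigma> = 0 then 1
      else let a0 = sqrt (real n) * \<sigma>; a = real (n + 1) / sqrt (real n) * \<sigma>
           in real n * exp a0 * a powi (- int n) * lower_gamma n a)"

definition upper_config :: "nat \<Rightarrow> real \<Rightarrow> real \<Rightarrow> nat \<Rightarrow> real" where
  "upper_config n \<mu> \<sigma> i =
     (let a0 = sqrt (real n) * \<sigma> in if i = 0 then \<mu> + a0 else \<mu> - a0 / real n)"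

definition lower_config :: "nat \<Rightarrow> real \<Rightarrow> real \<Rightarrow> nat \<Rightarrow> real" where
  "lower_config n \<mu> \<sigma> i =
     (let a0 = sqrt (real n) * \<sigma> in if i = 0 then \<mu> - a0 else \<mu> + a0 / real n)"

end

theory Submission imports Defs
begin

text \<open>
  The divided difference is \<open>exp[x\<^sub>0, \<dots>, x\<^sub>n] = \<Sum>k. h\<^sub>k(x) / (n + k)!\<close>, where the complete
  homogeneous symmetric polynomials \<open>h\<^sub>k\<close> have the generating function
  \<open>\<Prod>i. 1 / (1 - x\<^sub>i X)\<close>. Translating the nodes multiplies it by a constant, so all nodes may be
  assumed nonnegative. If three of the nodes are changed without changing their sum and their sum
  of squares, only the third elementary symmetric polynomial \<open>e\<close> of the three moves, and the
  generating function grows by \<open>(e' - e) X\<^sup>3\<close> times a series with nonnegative coefficients. Hence at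
  an extremum on the compact set of nodes with given mean and variance, \<open>e\<close> is extremal for every
  triple. This makes two nodes of every triple equal, with the third one on a prescribed side of
  them, which leaves only the configurations of the theorem.
\<close>

unbundle no vec_syntax
unbundle fps_syntax

section \<open>Geometric series and complete homogeneous symmetric polynomials\<close>

definition geom_fps :: "real \<Rightarrow> real fps" where
  "geom_fps c = Abs_fps (\<lambda>k. c ^ k)"

lemma geom_fps_nth [simp]: "geom_fps c $ k = c ^ k"
  by (simp add: geom_fps_def)

lemma geom_fps_0 [simp]: "geom_fps 0 = 1"
  by (rule fps_ext) (simp add: power_0_left)

lemma geom_fps_mult: "geom_fps c * (1 - fps_const c * fps_X) = 1"
proof (rule fps_ext)
  fix k show "(geom_fps c * (1 - fps_const c * fps_X)) $ k = (1 :: real fps) $ k"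
    by (cases k) (simp_all add: right_diff_distrib mult.left_commute[of "geom_fps c"])
qed

lemma geom_fps_diff:
  "geom_fps u - geom_fps v = fps_const (u - v) * fps_X * (geom_fps u * geom_fps v)"
proof -
  define U V where "U = 1 - fps_const u * fps_X" and "V = 1 - fps_const v * fps_X"
  have "geom_fps u * U = 1" "geom_fps v * V = 1"
    by (simp_all add: U_def V_def geom_fps_mult)
  then have "geom_fps u - geom_fps v = (V - U) * (geom_fps u * geom_fps v)"
    by algebra
  also have "V - U = fps_const (u - v) * fps_X"
    by (simp add: U_def V_def algebra_simps flip: fps_const_sub)
  finally show ?thesis .
qed

text \<open>The two products are reciprocals of cubics in \<open>fps_X\<close>. When the first two
  elementary symmetric polynomials agree, these cubics differ only in the coefficient of
  \<open>fps_X ^ 3\<close>.\<close>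

lemma geom_fps_triple_diff:
  assumes "y1 + y2 + y3 = x1 + x2 + x3"
    and "y1 * y2 + y1 * y3 + y2 * y3 = x1 * x2 + x1 * x3 + x2 * x3"
  shows "geom_fps y1 * geom_fps y2 * geom_fps y3 - geom_fps x1 * geom_fps x2 * geom_fps x3
    = fps_const (y1 * y2 * y3 - x1 * x2 * x3) * fps_X ^ 3
      * (geom_fps y1 * geom_fps y2 * geom_fps y3 * (geom_fps x1 * geom_fps x2 * geom_fps x3))"
proof -
  define P where "P a b c = (1 - fps_const a * fps_X) * (1 - fps_const b * fps_X)
    * (1 - fps_const c * fps_X)" for a b c :: real
  have inv: "geom_fps a * geom_fps b * geom_fps c * P a b c = 1" for a b c
    using geom_fps_mult[of a] geom_fps_mult[of b] geom_fps_mult[of c]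
    unfolding P_def by algebra
  have P: "P a b c = 1 - fps_const (a + b + c) * fps_X
      + fps_const (a * b + a * c + b * c) * fps_X ^ 2 - fps_const (a * b * c) * fps_X ^ 3"
    for a b c
    unfolding P_def fps_const_add[symmetric] fps_const_mult[symmetric] by algebra
  have "P x1 x2 x3 - P y1 y2 y3 = fps_const (y1 * y2 * y3 - x1 * x2 * x3) * fps_X ^ 3"
    unfolding P assms fps_const_sub[symmetric] by algebra
  moreover have "geom_fps y1 * geom_fps y2 * geom_fps y3 - geom_fps x1 * geom_fps x2 * geom_fps x3
    = (P x1 x2 x3 - P y1 y2 y3)
      * (geom_fps y1 * geom_fps y2 * geom_fps y3 * (geom_fps x1 * geom_fps x2 * geom_fps x3))"
    using inv[of x1 x2 x3] inv[of y1 y2 y3] by algebra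
  ultimately show ?thesis by simp
qed

text \<open>The coefficients are the complete homogeneous symmetric polynomials.\<close>

definition complete_fps :: "('i \<Rightarrow> real) \<Rightarrow> 'i set \<Rightarrow> real fps" where
  "complete_fps x I = (\<Prod>i\<in>I. geom_fps (x i))"

lemma complete_fps_cong: "(\<And>i. i \<in> I \<Longrightarrow> x i = y i) \<Longrightarrow> complete_fps x I = complete_fps y I"
  by (simp add: complete_fps_def)

lemma complete_fps_insert:
  "finite I \<Longrightarrow> i \<notin> I \<Longrightarrow> complete_fps x (insert i I) = geom_fps (x i) * complete_fps x I"
  by (simp add: complete_fps_def)

lemma complete_fps_insert_nth:
  "finite I \<Longrightarrow> i \<notin> I \<Longrightarrow>
    complete_fps x (insert i I) $ k = (\<Sum>j\<le>k. x i ^ j * complete_fps x I $ (k - j))"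
  by (simp add: complete_fps_insert fps_mult_nth atLeast0AtMost)

lemma fps_mult_nth_nonneg:
  fixes f g :: "real fps"
  assumes "\<And>k. f $ k \<ge> 0" "\<And>k. g $ k \<ge> 0"
  shows "(f * g) $ k \<ge> 0"
  by (simp add: fps_mult_nth assms sum_nonneg)

lemma complete_fps_nonneg:
  assumes "\<And>i. i \<in> I \<Longrightarrow> x i \<ge> 0"
  shows "complete_fps x I $ k \<ge> 0"
  using assms unfolding complete_fps_def
  by (induction I arbitrary: k rule: infinite_finite_induct)
    (auto intro!: fps_mult_nth_nonneg)

lemma complete_fps_nth_0 [simp]: "complete_fps x I $ 0 = 1"
  unfolding complete_fps_def
  by (induction I rule: infinite_finite_induct) simp_all

text \<open>Each monomial of degree \<open>k\<close> has coefficient 1 here and a multinomial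
  coefficient, at least 1, in the power on the right. The induction handles one variable at a time
  through the binomial theorem.\<close>

lemma abs_complete_fps_le:
  assumes "finite I"
  shows "\<bar>complete_fps x I $ k\<bar> \<le> (\<Sum>i\<in>I. \<bar>x i\<bar>) ^ k"
  using assms
proof (induction I arbitrary: k rule: finite_induct)
  case empty
  then show ?case by (simp add: complete_fps_def power_0_left)
next
  case (insert i I)
  define S where "S = (\<Sum>i\<in>I. \<bar>x i\<bar>)"
  have S: "S \<ge> 0" by (simp add: S_def sum_nonneg)
  have "\<bar>complete_fps x (insert i I) $ k\<bar> \<le> (\<Sum>j\<le>k. \<bar>x i\<bar> ^ j * \<bar>complete_fps x I $ (k - j)\<bar>)"
    using insert.hyps
    by (simp add: complete_fps_insert_nth order_trans[OF sum_abs] abs_mult power_abs)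
  also have "\<dots> \<le> (\<Sum>j\<le>k. real (k choose j) * \<bar>x i\<bar> ^ j * S ^ (k - j))"
  proof (rule sum_mono)
    fix j assume "j \<in> {..k}"
    then have "1 \<le> real (k choose j)"
      by (simp add: Suc_le_eq zero_less_binomial)
    then have "1 * (\<bar>x i\<bar> ^ j * \<bar>complete_fps x I $ (k - j)\<bar>)
        \<le> real (k choose j) * (\<bar>x i\<bar> ^ j * S ^ (k - j))"
      using insert.IH S unfolding S_def by (intro mult_mono) auto
    then show "\<bar>x i\<bar> ^ j * \<bar>complete_fps x I $ (k - j)\<bar>
        \<le> real (k choose j) * \<bar>x i\<bar> ^ j * S ^ (k - j)"
      by (simp add: mult.assoc)
  qed
  also have "\<dots> = (\<bar>x i\<bar> + S) ^ k"
    by (simp add: binomial_ring)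
  also have "\<bar>x i\<bar> + S = (\<Sum>i\<in>insert i I. \<bar>x i\<bar>)"
    using insert.hyps by (simp add: S_def)
  finally show ?case .
qed

lemma continuous_on_coordinate: "continuous_on A (\<lambda>x :: 'i \<Rightarrow> real. x i)"
  by (rule continuous_on_subset[OF continuous_on_product_coordinates]) simp

lemma continuous_on_complete_fps:
  "finite I \<Longrightarrow> continuous_on A (\<lambda>x :: 'i \<Rightarrow> real. complete_fps x I $ k)"
proof (induction I arbitrary: k rule: finite_induct)
  case empty
  then show ?case by (simp add: complete_fps_def)
next
  case (insert i I)
  then show ?case
    by (auto simp: complete_fps_insert_nth intro!: continuous_intros continuous_on_coordinate)
qed

text \<open>This is the divided difference of the \<open>m\<close>-th power. The factor
  \<open>fps_X ^ (card I - 1)\<close> shifts the degree and also records that the sum vanishes for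
  \<open>m < card I - 1\<close>.\<close>

lemma partial_fractions_power:
  assumes "finite I" "I \<noteq> {}" "inj_on x I"
  shows "(\<Sum>i\<in>I. x i ^ m / (\<Prod>j\<in>I - {i}. x i - x j))
    = (fps_X ^ (card I - 1) * complete_fps x I) $ m"
  using assms
\<comment> \<open>The induction is on the number of nodes because the recurrence compares two
  different subsets, each lacking one of two chosen nodes.\<close>
proof (induction "card I" arbitrary: I rule: less_induct)
  case less
  show ?case
  proof (cases "card I = 1")
    case True
    then obtain u where "I = {u}" by (rule card_1_singletonE)
    then show ?thesis by (simp add: complete_fps_def)
  next
    case False
    then have "\<not> card I \<le> Suc 0"
      using less.prems by (metis One_nat_def card_0_eq le_SucE le_zero_eq)
    then obtain u v where uv: "u \<in> I" "v \<in> I" "u \<noteq> v"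
      using less.prems(1) by (auto simp: card_le_Suc0_iff_eq)
    define J where "J = I - {u, v}"
    have J: "finite J" "u \<notin> J" "v \<notin> J" "I = insert u (insert v J)"
      using uv less.prems by (auto simp: J_def)
    define D where "D K = (\<Sum>i\<in>K. x i ^ m / (\<Prod>j\<in>K - {i}. x i - x j))" for K
    have ne: "x i \<noteq> x j" if "i \<in> I" "j \<in> I" "i \<noteq> j" for i j
      using less.prems(3) that by (auto simp: inj_on_def)
    have Dins: "D (insert w J) = x w ^ m / (\<Prod>j\<in>J. x w - x j)
        + (\<Sum>i\<in>J. x i ^ m / ((x i - x w) * (\<Prod>j\<in>J - {i}. x i - x j)))" if "w \<notin> J" for w
    proof -
      have "insert w J - {i} = insert w (J - {i})" if "i \<in> J" for i
        using that \<open>w \<notin> J\<close> by auto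
      then show ?thesis using J that by (simp add: D_def)
    qed
    have D1: "D I = x u ^ m / ((x u - x v) * (\<Prod>j\<in>J. x u - x j))
        + (x v ^ m / ((x v - x u) * (\<Prod>j\<in>J. x v - x j))
        + (\<Sum>i\<in>J. x i ^ m / ((x i - x u) * ((x i - x v) * (\<Prod>j\<in>J - {i}. x i - x j)))))"
    proof -
      have "I - {i} = insert u (insert v (J - {i}))" if "i \<in> J" for i
        using that J by auto
      moreover have "I - {u} = insert v J" "I - {v} = insert u J"
        using J uv by auto
      ultimately show ?thesis using J uv by (simp add: D_def)
    qed
    \<comment> \<open>The classical recurrence for divided differences; \<open>geom_fps_diff\<close>
      gives the same recurrence for the generating functions.\<close>
    have "(x u - x v) * D I = D (insert u J) - D (insert v J)"
    proof -
      have "(x u - x v) * (x i ^ m / ((x i - x u) * ((x i - x v) * Q)))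
          = x i ^ m / ((x i - x u) * Q) - x i ^ m / ((x i - x v) * Q)" if "i \<in> J" for i Q
      proof (cases "Q = 0")
        case False
        have "x i - x u \<noteq> 0" "x i - x v \<noteq> 0"
          using ne[of i u] ne[of i v] that J by auto
        with False show ?thesis by (simp add: divide_simps) algebra
      qed auto
      moreover have "(x u - x v) * (x u ^ m / ((x u - x v) * Q)) = x u ^ m / Q"
        "(x u - x v) * (x v ^ m / ((x v - x u) * Q)) = - (x v ^ m / Q)" for Q
        using ne[OF uv] by (auto simp: divide_simps) (simp_all add: algebra_simps)
      ultimately show ?thesis
        unfolding D1 Dins[OF J(2)] Dins[OF J(3)]
        by (simp add: distrib_left sum_distrib_left sum_subtractf cong: sum.cong)
    qed
    also have "D (insert w J) = (fps_X ^ card J * complete_fps x (insert w J)) $ m"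
      if "w \<in> {u, v}" for w
    proof -
      have "card (insert w J) < card I"
        using J uv that by auto
      moreover have "inj_on x (insert w J)"
        by (rule inj_on_subset[OF less.prems(3)]) (use J that in auto)
      ultimately have "D (insert w J)
          = (fps_X ^ (card (insert w J) - 1) * complete_fps x (insert w J)) $ m"
        unfolding D_def using J by (intro less.hyps) auto
      then show ?thesis using J that by auto
    qed
    then have "D (insert u J) - D (insert v J)
        = (fps_X ^ card J * (complete_fps x (insert u J) - complete_fps x (insert v J))) $ m"
      by (simp add: right_diff_distrib)
    also have "complete_fps x (insert u J) - complete_fps x (insert v J)
        = (geom_fps (x u) - geom_fps (x v)) * complete_fps x J"
      using J by (simp add: complete_fps_insert left_diff_distrib)
    also have "\<dots> = fps_const (x u - x v) * fps_X * complete_fps x I"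
      unfolding geom_fps_diff J(4) using J uv by (simp add: complete_fps_insert mult.assoc)
    also have "fps_X ^ card J * (fps_const (x u - x v) * fps_X * complete_fps x I)
        = fps_const (x u - x v) * (fps_X ^ (card I - 1) * complete_fps x I)"
      using J uv by (simp add: algebra_simps)
    finally have "D I = (fps_X ^ (card I - 1) * complete_fps x I) $ m"
      using ne[OF uv] by simp
    then show ?thesis by (simp add: D_def)
  qed
qed

section \<open>The divided difference of the exponential as a power series\<close>

text \<open>The series makes sense for coinciding nodes as well, so it serves as an explicit
  continuous extension of the divided difference.\<close>

definition exp_dd :: "nat \<Rightarrow> (nat \<Rightarrow> real) \<Rightarrow> real" where
  "exp_dd n x = (\<Sum>k. complete_fps x {..n} $ k / fact (n + k))"

lemma abs_exp_dd_term_le: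
  assumes "(\<Sum>i\<le>n. \<bar>x i\<bar>) \<le> R"
  shows "\<bar>complete_fps x {..n} $ k / fact (n + k)\<bar> \<le> R ^ k / fact k"
proof -
  have "\<bar>complete_fps x {..n} $ k\<bar> \<le> R ^ k"
    by (rule order_trans[OF abs_complete_fps_le])
      (auto intro!: power_mono assms sum_nonneg)
  moreover have "(fact k :: real) \<le> fact (n + k)"
    by (rule fact_mono) simp
  ultimately show ?thesis
    by (simp add: abs_divide frac_le)
qed

lemma summable_power_div_fact: "summable (\<lambda>k. R ^ k / fact k :: real)"
  using summable_exp[of R] by (simp add: divide_inverse mult.commute)

lemma summable_exp_dd: "summable (\<lambda>k. complete_fps x {..n} $ k / fact (n + k))"
  by (rule summable_comparison_test'[OF summable_power_div_fact])
    (use abs_exp_dd_term_le[OF order_refl] in auto)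

text \<open>Near each point the sum of the absolute values of the nodes stays below some
  \<open>R\<close>, so the series \<open>R ^ k / fact k\<close> dominates and convergence is locally
  uniform.\<close>

lemma continuous_on_exp_dd: "continuous_on A (exp_dd n)"
proof -
  have "isCont (exp_dd n) x" for x
  proof -
    define R where "R = (\<Sum>i\<le>n. \<bar>x i\<bar>) + 1"
    define U where "U = {y :: nat \<Rightarrow> real. (\<Sum>i\<le>n. \<bar>y i\<bar>) < R}"
    have "open U"
      unfolding U_def
      by (intro open_Collect_less continuous_intros continuous_on_coordinate)
    have "uniform_limit U (\<lambda>m y. \<Sum>k<m. complete_fps y {..n} $ k / fact (n + k))
        (\<lambda>y. \<Sum>k. complete_fps y {..n} $ k / fact (n + k)) sequentially"
      by (rule Weierstrass_m_test[OF _ summable_power_div_fact[of R]])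
        (use abs_exp_dd_term_le in \<open>auto simp: U_def less_imp_le\<close>)
    then have "continuous_on U (\<lambda>y. \<Sum>k. complete_fps y {..n} $ k / fact (n + k))"
      by (rule uniform_limit_theorem[rotated])
        (auto intro!: always_eventually continuous_intros continuous_on_complete_fps)
    moreover have "x \<in> U" by (simp add: U_def R_def)
    ultimately show ?thesis
      using \<open>open U\<close> by (simp add: continuous_on_eq_continuous_at exp_dd_def[abs_def])
  qed
  then show ?thesis by (simp add: continuous_at_imp_continuous_on)
qed

text \<open>Expand the exponential at each node and apply \<open>partial_fractions_power\<close> to
  every power.\<close>

lemma divdiff_distinct_exp:
  assumes "inj_on x {..n}"
  shows "divdiff_distinct exp n x = exp_dd n x"
proof -
  define P where "P i = (\<Prod>j\<in>{..n} - {i}. x i - x j)" for i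
  define F where "F m = (fps_X ^ n * complete_fps x {..n}) $ m" for m
  have F: "(\<Sum>i\<le>n. x i ^ m / P i) = F m" for m
    using partial_fractions_power[of "{..n}" x m] assms by (simp add: F_def P_def)
  have exps: "(\<lambda>m. t ^ m / fact m) sums exp t" for t :: real
    using exp_converges[of t] by (simp add: divide_inverse mult.commute)
  have "(\<lambda>m. \<Sum>i\<le>n. x i ^ m / fact m / P i) sums (\<Sum>i\<le>n. exp (x i) / P i)"
    by (intro sums_sum sums_divide exps)
  moreover have "(\<Sum>i\<le>n. x i ^ m / fact m / P i) = F m / fact m" for m
    by (simp add: sum_divide_distrib flip: F) (simp add: mult.commute)
  ultimately have "(\<lambda>m. F m / fact m) sums divdiff_distinct exp n x"
    by (simp add: divdiff_distinct_def P_def)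
  \<comment> \<open>The terms with \<open>m < n\<close> vanish; dropping them turns the index
    \<open>m\<close> into \<open>k + n\<close>, which is the origin of \<open>fact (n + k)\<close>
    in \<open>exp_dd\<close>.\<close>
  then have "(\<lambda>k. F (k + n) / fact (k + n)) sums (divdiff_distinct exp n x - (\<Sum>m<n. F m / fact m))"
    by (rule sums_split_initial_segment)
  moreover have "F m = 0" if "m < n" for m
    using that by (simp add: F_def fps_X_power_mult_nth)
  moreover have "F (k + n) = complete_fps x {..n} $ k" for k
    by (simp add: F_def fps_X_power_mult_nth)
  ultimately show ?thesis
    by (simp add: exp_dd_def sums_iff add.commute)
qed

lemma continuous_on_UNIV_tendsto:
  "continuous_on UNIV f \<Longrightarrow> (f \<longlongrightarrow> f x) (at x within A)"
  by (auto simp: continuous_on_def intro: tendsto_within_subset)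

text \<open>Limits along distinct nodes are unique only if this filter is nontrivial. The perturbed
  nodes \<open>x i + e * real i\<close> are distinct for all but finitely many
  \<open>e\<close>.\<close>

lemma distinct_nodes_at_neq_bot:
  fixes x :: "nat \<Rightarrow> real"
  assumes "n \<ge> 1"
  shows "at x within {y. inj_on y {..n}} \<noteq> bot"
proof -
  define g where "g e i = x i + e * real i" for e i
  have "eventually (\<lambda>e. inj_on (g e) {..n}) (at_right 0)"
  proof -
    have "eventually (\<lambda>e. \<forall>i\<in>{..n}. \<forall>j\<in>{..n}. i \<noteq> j \<longrightarrow> e \<noteq> (x j - x i) / (real i - real j))
      (at_right 0)"
      by (intro eventually_ball_finite ballI) (auto intro: eventually_neq_at_within)
    then show ?thesis
      by eventually_elim (auto simp: inj_on_def g_def field_simps)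
  qed
  \<comment> \<open>The filter \<open>at x\<close> excludes \<open>x\<close> itself, so the
    perturbation has to move some coordinate; coordinate 1 does.\<close>
  moreover have "eventually (\<lambda>e :: real. g e \<noteq> x) (at_right 0)"
    using eventually_at_right_less[of 0]
  proof eventually_elim
    case (elim e)
    then have "g e 1 \<noteq> x 1" by (simp add: g_def)
    then show ?case by auto
  qed
  moreover have "(g \<longlongrightarrow> x) (at_right 0)"
  proof -
    have "continuous_on UNIV g"
      unfolding g_def by (intro continuous_on_coordinatewise_then_product continuous_intros)
    then have "(g \<longlongrightarrow> g 0) (at_right 0)"
      by (rule continuous_on_UNIV_tendsto)
    moreover have "g 0 = x" by (simp add: g_def fun_eq_iff)
    ultimately show ?thesis by simp
  qed
  ultimately have "filterlim g (at x within {y. inj_on y {..n}}) (at_right 0)"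
    unfolding filterlim_at by (auto elim: eventually_elim2)
  then show ?thesis
    by (metis filterlim_def filtermap_bot_iff le_bot trivial_limit_at_right_real)
qed

lemma tendsto_exp_dd: "(exp_dd n \<longlongrightarrow> exp_dd n x) (at x within A)"
  by (rule continuous_on_UNIV_tendsto) (rule continuous_on_exp_dd)

lemma divdiff_exp:
  assumes "n \<ge> 1"
  shows "divdiff exp n x = exp_dd n x"
proof (cases "inj_on x {..n}")
  case True
  then show ?thesis by (simp add: divdiff_def divdiff_distinct_exp)
next
  case False
  have "(divdiff_distinct exp n \<longlongrightarrow> exp_dd n x) (at x within {y. inj_on y {..n}})"
    by (rule Lim_transform_within[OF tendsto_exp_dd, of 1]) (auto simp: divdiff_distinct_exp)
  then show ?thesis
    using False distinct_nodes_at_neq_bot[OF assms] by (simp add: divdiff_def tendsto_Lim)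
qed

text \<open>The factor \<open>exp c\<close> is hard to see in the series but immediate in the
  partial fraction formula for distinct nodes; continuity carries it over to all nodes.\<close>

lemma exp_dd_shift:
  assumes "n \<ge> 1"
  shows "exp_dd n (\<lambda>i. x i + c) = exp c * exp_dd n x"
proof (rule tendsto_unique[OF distinct_nodes_at_neq_bot[OF assms]])
  let ?F = "at x within {y. inj_on y {..n}}"
  show "((\<lambda>y. exp c * exp_dd n y) \<longlongrightarrow> exp c * exp_dd n x) ?F"
    by (intro tendsto_intros tendsto_exp_dd)
  have "((\<lambda>y. exp_dd n (\<lambda>i. y i + c)) \<longlongrightarrow> exp_dd n (\<lambda>i. x i + c)) ?F"
  proof -
    have "continuous_on UNIV (exp_dd n \<circ> (\<lambda>y i. y i + c))"
      by (intro continuous_on_compose continuous_on_exp_dd continuous_on_coordinatewise_then_product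
          continuous_intros continuous_on_coordinate)
    from continuous_on_UNIV_tendsto[OF this] show ?thesis
      by (simp add: comp_def)
  qed
  moreover have "eventually (\<lambda>y. exp_dd n (\<lambda>i. y i + c) = exp c * exp_dd n y) ?F"
    unfolding eventually_at_filter
  proof (intro always_eventually allI impI)
    fix y :: "nat \<Rightarrow> real" assume "y \<in> {y. inj_on y {..n}}"
    then have inj: "inj_on y {..n}" "inj_on (\<lambda>i. y i + c) {..n}"
      by (auto simp: inj_on_def)
    then show "exp_dd n (\<lambda>i. y i + c) = exp c * exp_dd n y"
      by (simp add: divdiff_distinct_def exp_add sum_distrib_left mult.commute
          flip: divdiff_distinct_exp)
  qed
  ultimately show "((\<lambda>y. exp c * exp_dd n y) \<longlongrightarrow> exp_dd n (\<lambda>i. x i + c)) ?F"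
    by (rule Lim_transform_eventually)
qed

lemma exp_dd_cong: "(\<And>i. i \<le> n \<Longrightarrow> x i = y i) \<Longrightarrow> exp_dd n x = exp_dd n y"
  using complete_fps_cong[of "{..n}" x y] by (simp add: exp_dd_def)

lemma exp_dd_permute:
  assumes "p permutes {..n}"
  shows "exp_dd n (x \<circ> p) = exp_dd n x"
  using prod.permute[OF assms, of "\<lambda>i. geom_fps (x i)"]
  by (simp add: exp_dd_def complete_fps_def comp_def)

section \<open>Evaluation at the extremal configurations by the incomplete gamma function\<close>

lemma complete_fps_single_variable:
  "complete_fps (\<lambda>i. if i = 0 then a else 0) {..n :: nat} = geom_fps a"
proof -
  have "{..n} = insert 0 {1..n}" by auto
  then show ?thesis
    by (simp add: complete_fps_insert) (simp add: complete_fps_def)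
qed

lemma exp_dd_single_node:
  "exp_dd n (\<lambda>i. if i = 0 then a else 0) = (\<Sum>k. a ^ k / fact (n + k))"
  by (simp add: exp_dd_def complete_fps_single_variable)

text \<open>The tail of the exponential series links the single-node value of \<open>exp_dd\<close>
  to the closed form of the incomplete gamma function.\<close>

lemma exp_minus_partial_sum:
  "exp a - (\<Sum>k<n. a ^ k / fact k) = a ^ n * (\<Sum>k. a ^ k / fact (n + k))" for a :: real
proof -
  have "(\<lambda>m. a ^ m / fact m) sums exp a"
    using exp_converges[of a] by (simp add: divide_inverse mult.commute)
  then have "(\<lambda>k. a ^ (k + n) / fact (k + n)) sums (exp a - (\<Sum>k<n. a ^ k / fact k))"
    by (rule sums_split_initial_segment)
  then have sums: "(\<lambda>k. a ^ n * (a ^ k / fact (n + k))) sums (exp a - (\<Sum>k<n. a ^ k / fact k))"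
    by (simp add: power_add add.commute mult.commute)
  have "summable (\<lambda>k. a ^ k / fact (n + k))"
    using summable_exp_dd[of "\<lambda>i. if i = 0 then a else 0" n]
    by (simp add: complete_fps_single_variable)
  then show ?thesis
    using sums_unique[OF sums] by (simp only: suminf_mult)
qed

text \<open>The derivatives of consecutive terms telescope, leaving only the last one. This supplies
  an antiderivative for the integrand of \<open>lower_gamma\<close>.\<close>

lemma exp_partial_sum_has_derivative:
  "((\<lambda>t. exp (- t) * (\<Sum>k\<le>m. t ^ k / fact k)) has_real_derivative
    - (t ^ m * exp (- t) / fact m)) (at t)"
proof (induction m)
  case 0
  show ?case by (auto intro!: derivative_eq_intros)
next
  case (Suc m)
  have "((\<lambda>t. exp (- t) * (t ^ Suc m / fact (Suc m))) has_real_derivative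
      t ^ m * exp (- t) / fact m - t ^ Suc m * exp (- t) / fact (Suc m)) (at t)"
    by (rule derivative_eq_intros refl | simp)+
  from DERIV_add[OF Suc this] show ?case
    by (simp add: distrib_left)
qed

lemma lower_gamma_eq:
  assumes "n \<ge> 1"
  shows "lower_gamma n z = fact (n - 1) * (1 - exp (- z) * (\<Sum>k<n. z ^ k / fact k))"
proof -
  define m where "m = n - 1"
  have n: "n = Suc m" using assms by (simp add: m_def)
  define F where "F t = - (fact m * (exp (- t) * (\<Sum>k\<le>m. t ^ k / fact k)))" for t :: real
  have "(F has_real_derivative t ^ m * exp (- t)) (at t)" for t
    unfolding F_def
    by (rule derivative_eq_intros exp_partial_sum_has_derivative refl | simp)+
  then have "lower_gamma n z = F z - F 0"
    unfolding lower_gamma_def n diff_Suc_1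
    by (intro interval_integral_FTC_finite continuous_intros)
      (simp add: has_real_derivative_iff_has_vector_derivative has_vector_derivative_at_within)
  also have "F 0 = - fact m"
  proof -
    have "(\<Sum>k\<le>m. 0 ^ k / fact k :: real) = (\<Sum>k\<in>{0}. 0 ^ k / fact k)"
      by (rule sum.mono_neutral_right) auto
    then show ?thesis by (simp add: F_def)
  qed
  finally show ?thesis
    by (simp add: F_def n lessThan_Suc_atMost algebra_simps)
qed

text \<open>Translating by the common value \<open>c\<close> of the equal nodes leaves the single
  nonzero node \<open>a\<close>. The sign of \<open>\<tau>\<close> is arbitrary, so negative
  \<open>\<tau>\<close> covers the lower configuration.\<close>

lemma exp_dd_upper_config:
  assumes "n \<ge> 1"
  shows "fact n * exp_dd n (upper_config n \<mu> \<tau>) = exp \<mu> * M_bound n \<tau>"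
proof -
  define a0 a c where "a0 = sqrt (real n) * \<tau>" and "a = real (n + 1) / sqrt (real n) * \<tau>"
    and "c = \<mu> - a0 / real n"
  define S where "S = (\<Sum>k. a ^ k / fact (n + k))"
  have sq: "sqrt (real n) * sqrt (real n) = real n" "sqrt (real n) > 0" using assms by auto
  \<comment> \<open>Thus \<open>a\<close> is the signed distance from the equal nodes to the
    exceptional one.\<close>
  have a: "a = a0 + a0 / real n"
    unfolding a_def a0_def using sq assms by (simp add: field_simps)
  have "upper_config n \<mu> \<tau> = (\<lambda>i. (if i = 0 then a else 0) + c)"
    by (auto simp: upper_config_def Let_def c_def a a0_def)
  then have dd: "exp_dd n (upper_config n \<mu> \<tau>) = exp c * S"
    using exp_dd_shift[OF assms] by (simp add: exp_dd_single_node S_def)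
  show ?thesis
  proof (cases "\<tau> = 0")
    case True
    \<comment> \<open>Only the term \<open>k = 0\<close> survives, which matches the value 1 that
      \<open>M_bound\<close> takes at zero.\<close>
    have "(\<Sum>k. 0 ^ k / fact (n + k) :: real) = 1 / fact n"
      by (subst suminf_finite[of "{0}"]) (auto simp: power_0_left)
    then have "S = 1 / fact n" using True by (simp add: S_def a_def)
    then show ?thesis using True dd by (simp add: M_bound_def c_def a0_def)
  next
    case False
    then have "a \<noteq> 0" using sq by (simp add: a_def)
    have "lower_gamma n a = fact (n - 1) * exp (- a) * (exp a - (\<Sum>k<n. a ^ k / fact k))"
      unfolding lower_gamma_eq[OF assms] by (simp add: algebra_simps flip: exp_add)
    also have "\<dots> = fact (n - 1) * exp (- a) * a ^ n * S"
      unfolding exp_minus_partial_sum S_def by simp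
    finally have g: "lower_gamma n a = fact (n - 1) * exp (- a) * a ^ n * S" .
    have "M_bound n \<tau> = real n * exp a0 * a powi (- int n) * lower_gamma n a"
      using False by (simp add: M_bound_def Let_def a0_def a_def)
    also have "\<dots> = (real n * fact (n - 1)) * exp (a0 - a) * S"
      using \<open>a \<noteq> 0\<close> by (simp add: g power_int_minus exp_diff exp_minus field_simps)
    also have "real n * fact (n - 1) = fact n"
      using assms by (simp add: fact_reduce)
    finally have "exp \<mu> * M_bound n \<tau> = fact n * (exp \<mu> * exp (a0 - a)) * S" by simp
    also have "exp \<mu> * exp (a0 - a) = exp c"
      by (simp add: c_def a flip: exp_add)
    finally show ?thesis using dd by simp
  qed
qed

section \<open>Changing three nodes with fixed sum and sum of squares\<close>

text \<open>The bound is the value at \<open>(2 * d, - d, - d)\<close>, and the gap factors as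
  \<open>(u + d)\<^sup>2 * (2 * d - u)\<close>. Since \<open>u\<close> is the largest entry it is
  nonnegative, and \<open>v \<noteq> w\<close> forces \<open>u < 2 * d\<close>.\<close>

lemma triple_product_less:
  fixes u v w d :: real
  assumes "u + v + w = 0" "u\<^sup>2 + v\<^sup>2 + w\<^sup>2 = 6 * d\<^sup>2" "d \<ge> 0" "v \<le> u" "w \<le> u" "v \<noteq> w"
  shows "u * v * w < 2 * d ^ 3"
proof -
  have u: "u \<ge> 0" and w: "w = - u - v" using assms by auto
  have "d \<noteq> 0"
  proof
    assume "d = 0"
    then have "v\<^sup>2 = 0 \<and> w\<^sup>2 = 0"
      using assms(2) by (smt (verit) zero_le_power2 power_zero_numeral)
    then show False using assms by simp
  qed
  with assms(3) have d: "d > 0" by simp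
  have "(v - w)\<^sup>2 > 0" using assms by simp
  then have "u\<^sup>2 < (2 * d)\<^sup>2"
    using assms(2) unfolding w by (simp add: power2_eq_square algebra_simps)
  then have "u < 2 * d" by (rule power_less_imp_less_base) (use d in simp)
  then have "0 < (u + d)\<^sup>2 * (2 * d - u)" using u d by simp
  also have "(u + d)\<^sup>2 * (2 * d - u) = 2 * d ^ 3 - u * v * w"
  proof -
    have "u\<^sup>2 + v\<^sup>2 + u * v = 3 * d\<^sup>2"
      using assms(2) unfolding w by (simp add: power2_eq_square algebra_simps)
    then show ?thesis unfolding w by algebra
  qed
  finally show ?thesis by simp
qed

text \<open>The sign \<open>s\<close> treats maxima (\<open>s = 1\<close>) and minima (\<open>s = - 1\<close>) at once.\<close>

lemma triple_improvement:
  fixes a b c s :: real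
  assumes "s = 1 \<or> s = - 1" "s * b \<le> s * a" "s * c \<le> s * a" "b \<noteq> c"
  obtains a' b' c' where "a' + b' + c' = a + b + c" "a'\<^sup>2 + b'\<^sup>2 + c'\<^sup>2 = a\<^sup>2 + b\<^sup>2 + c\<^sup>2"
    "s * (a * b * c) < s * (a' * b' * c')"
proof -
  define m where "m = (a + b + c) / 3"
  define u v w where "u = a - m" and "v = b - m" and "w = c - m"
  have abc: "a = m + u" "b = m + v" "c = m + w" by (simp_all add: u_def v_def w_def)
  have uvw: "u + v + w = 0" by (simp add: u_def v_def w_def m_def field_simps)
  \<comment> \<open>The scale at which the deviations \<open>(2 * d, - d, - d)\<close> have the same
    sum of squares as \<open>u\<close>, \<open>v\<close>, \<open>w\<close>.\<close>
  define d where "d = sqrt ((u\<^sup>2 + v\<^sup>2 + w\<^sup>2) / 6)"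
  have d: "d \<ge> 0" "u\<^sup>2 + v\<^sup>2 + w\<^sup>2 = 6 * d\<^sup>2" by (simp_all add: d_def)
  have s2: "s * s = 1" using assms(1) by auto
  have "(s * u) * (s * v) * (s * w) < 2 * d ^ 3"
  proof (rule triple_product_less)
    show "s * u + s * v + s * w = 0" using uvw by (simp flip: distrib_left)
    show "(s * u)\<^sup>2 + (s * v)\<^sup>2 + (s * w)\<^sup>2 = 6 * d\<^sup>2"
      using d(2) s2 by algebra
    show "s * v \<le> s * u" "s * w \<le> s * u" "s * v \<noteq> s * w"
      using assms by (auto simp: abc)
  qed (rule d)
  also have "(s * u) * (s * v) * (s * w) = s * (u * v * w)"
    using s2 by algebra
  finally have less: "s * (u * v * w) < 2 * d ^ 3" .
  show thesis
  proof (rule that[of "m + 2 * s * d" "m - s * d" "m - s * d"])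
    show "m + 2 * s * d + (m - s * d) + (m - s * d) = a + b + c"
      by (simp add: m_def field_simps)
    show "(m + 2 * s * d)\<^sup>2 + (m - s * d)\<^sup>2 + (m - s * d)\<^sup>2 = a\<^sup>2 + b\<^sup>2 + c\<^sup>2"
      using d(2) uvw s2 unfolding abc by algebra
    \<comment> \<open>With \<open>m\<close> and \<open>d\<close> fixed, only the product of the
      deviations can change.\<close>
    have "a * b * c = m ^ 3 - 3 * m * d\<^sup>2 + u * v * w"
    proof -
      have w: "w = - u - v" using uvw by simp
      have "u\<^sup>2 + v\<^sup>2 + u * v = 3 * d\<^sup>2"
        using d(2) unfolding w by (simp add: power2_eq_square algebra_simps)
      then show ?thesis unfolding abc w by algebra
    qed
    then have "s * (a * b * c) = s * (m ^ 3 - 3 * m * d\<^sup>2) + s * (u * v * w)"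
      by (simp add: distrib_left)
    also have "\<dots> < s * (m ^ 3 - 3 * m * d\<^sup>2) + 2 * d ^ 3" using less by simp
    also have "\<dots> = s * ((m + 2 * s * d) * (m - s * d) * (m - s * d))"
      using s2 by algebra
    finally show "s * (a * b * c) < s * ((m + 2 * s * d) * (m - s * d) * (m - s * d))" .
  qed
qed

lemma complete_fps_triple:
  assumes "finite I" "i \<in> I" "j \<in> I" "k \<in> I" "i \<noteq> j" "i \<noteq> k" "j \<noteq> k"
  shows "complete_fps x I
    = geom_fps (x i) * geom_fps (x j) * geom_fps (x k) * complete_fps x (I - {i, j, k})"
proof -
  have "I = insert i (insert j (insert k (I - {i, j, k})))" using assms by auto
  then have "complete_fps x I = complete_fps x (insert i (insert j (insert k (I - {i, j, k}))))"
    by simp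
  then show ?thesis using assms by (simp add: complete_fps_insert mult.assoc)
qed

text \<open>The generating function changes by \<open>p * X ^ 3 * Q\<close>, where \<open>Q\<close>
  has nonnegative coefficients and constant term 1. So no term of the series decreases, and the term
  of index 3 strictly increases.\<close>

lemma exp_dd_triple_less:
  assumes ijk: "i \<le> n" "j \<le> n" "k \<le> n" "i \<noteq> j" "i \<noteq> k" "j \<noteq> k"
    and eq: "\<And>l. l \<notin> {i, j, k} \<Longrightarrow> y l = x l"
    and sum: "y i + y j + y k = x i + x j + x k"
    and sq: "(y i)\<^sup>2 + (y j)\<^sup>2 + (y k)\<^sup>2 = (x i)\<^sup>2 + (x j)\<^sup>2 + (x k)\<^sup>2"
    and less: "x i * x j * x k < y i * y j * y k"
    and nonneg: "\<And>l. l \<le> n \<Longrightarrow> x l \<ge> 0" "\<And>l. l \<le> n \<Longrightarrow> y l \<ge> 0"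
  shows "exp_dd n x < exp_dd n y"
proof -
  define T where "T z = geom_fps (z i) * geom_fps (z j) * geom_fps (z k)" for z
  define R where "R = complete_fps x ({..n} - {i, j, k})"
  define p where "p = y i * y j * y k - x i * x j * x k"
  define Q where "Q = T y * complete_fps x {..n}"
  have p: "p > 0" using less by (simp add: p_def)
  have Hx: "complete_fps x {..n} = T x * R"
    using ijk by (simp add: complete_fps_triple T_def R_def)
  have "complete_fps y ({..n} - {i, j, k}) = R"
    unfolding R_def by (rule complete_fps_cong) (simp add: eq)
  then have Hy: "complete_fps y {..n} = T y * R"
    using complete_fps_triple[of "{..n}" i j k y] ijk by (simp add: T_def)
  \<comment> \<open>Equal sums and equal sums of squares give equal second elementary symmetric
    polynomials.\<close>
  have "y i * y j + y i * y k + y j * y k = x i * x j + x i * x k + x j * x k"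
    using sum sq by algebra
  from geom_fps_triple_diff[OF sum this]
  have "T y - T x = fps_const p * fps_X ^ 3 * (T y * T x)"
    unfolding T_def p_def .
  then have "complete_fps y {..n} - complete_fps x {..n} = fps_const p * (fps_X ^ 3 * Q)"
    unfolding Q_def Hx Hy by algebra
  then have diff: "complete_fps y {..n} $ l - complete_fps x {..n} $ l = p * (fps_X ^ 3 * Q) $ l" for l
    by (metis fps_sub_nth fps_mult_left_const_nth)
  define q where "q l = (complete_fps y {..n} $ l / fact (n + l)) - (complete_fps x {..n} $ l / fact (n + l))" for l
  have q: "q l = p * (fps_X ^ 3 * Q) $ l / fact (n + l)" for l
    by (simp only: q_def flip: diff diff_divide_distrib)
  have Qnn: "Q $ l \<ge> 0" for l
    unfolding Q_def T_def using nonneg ijk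
    by (intro fps_mult_nth_nonneg complete_fps_nonneg) auto
  have "Q $ 0 = 1" by (simp add: Q_def T_def)
  have "0 < (\<Sum>l. q l)"
  proof (rule suminf_pos2[where i = 3])
    show "summable q" unfolding q_def by (intro summable_diff summable_exp_dd)
    show "0 \<le> q l" for l using p Qnn by (simp add: q fps_X_power_mult_nth)
    show "0 < q 3" using p \<open>Q $ 0 = 1\<close> by (simp add: q fps_X_power_mult_nth)
  qed
  also have "(\<Sum>l. q l) = exp_dd n y - exp_dd n x"
    unfolding q_def exp_dd_def by (rule suminf_diff[symmetric]) (rule summable_exp_dd)+
  finally show ?thesis by simp
qed

section \<open>Extremal nodes under fixed moments\<close>

text \<open>The coordinates beyond \<open>n\<close> are fixed only to make the set compact.\<close>

definition moment_sphere :: "nat \<Rightarrow> real \<Rightarrow> real \<Rightarrow> (nat \<Rightarrow> real) set" where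
  "moment_sphere n A B = {y. (\<Sum>i\<le>n. y i) = A \<and> (\<Sum>i\<le>n. (y i)\<^sup>2) = B \<and> (\<forall>i. i > n \<longrightarrow> y i = 0)}"

text \<open>The set is closed and lies in a product of compact intervals, which is compact by
  Tychonoff's theorem.\<close>

lemma compact_moment_sphere: "compact (moment_sphere n A B)"
proof -
  \<comment> \<open>Chosen so that \<open>\<bar>y i\<bar> \<le> (y i)\<^sup>2 + 1 \<le> b\<close>;
    the absolute value of \<open>B\<close> keeps the zero coordinates inside the box in every
    case.\<close>
  define b where "b = \<bar>B\<bar> + 1"
  have "compactin (product_topology (\<lambda>i :: nat. euclidean) UNIV) (PiE UNIV (\<lambda>i. {- b..b}))"
    by (simp add: compactin_PiE)
  then have "compact (PiE UNIV (\<lambda>i :: nat. {- b..b}))"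
    by (simp add: euclidean_product_topology)
  moreover have "moment_sphere n A B =
    {y. (\<Sum>i\<le>n. y i) = A} \<inter> ({y. (\<Sum>i\<le>n. (y i)\<^sup>2) = B} \<inter> (\<Inter>i\<in>{n<..}. {y. y i = 0}))"
    by (auto simp: moment_sphere_def)
  then have "closed (moment_sphere n A B)"
    by (auto intro!: closed_Int closed_INT closed_Collect_eq continuous_intros continuous_on_coordinate)
  moreover have "moment_sphere n A B \<subseteq> PiE UNIV (\<lambda>i. {- b..b})"
  proof
    fix y assume y: "y \<in> moment_sphere n A B"
    have "\<bar>y i\<bar> \<le> b" for i
    proof (cases "i \<le> n")
      case True
      then have "(y i)\<^sup>2 \<le> (\<Sum>i\<le>n. (y i)\<^sup>2)" by (intro member_le_sum) auto
      also have "\<dots> = B" using y by (simp add: moment_sphere_def)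
      finally have "(y i)\<^sup>2 \<le> B" .
      moreover have "\<bar>y i\<bar> \<le> (y i)\<^sup>2 + 1"
        using zero_le_power2[of "\<bar>y i\<bar> - 1/2"] by (simp add: power2_eq_square algebra_simps)
      ultimately show ?thesis by (simp add: b_def)
    qed (use y in \<open>simp add: moment_sphere_def b_def\<close>)
    then show "y \<in> PiE UNIV (\<lambda>i. {- b..b})" by (auto simp: abs_le_iff minus_le_iff)
  qed
  ultimately show ?thesis by (metis closed_Int_compact Int_absorb2)
qed

text \<open>Otherwise \<open>triple_improvement\<close> yields a better point of the same set.
  Nonnegativity is assumed on the whole set because the comparison needs it for the new point
  too.\<close>

lemma exp_dd_maximizer_two_values:
  assumes s: "s = 1 \<or> s = - 1"
    and nonneg: "\<forall>y\<in>moment_sphere n A B. \<forall>i\<le>n. y i \<ge> 0"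
    and z: "z \<in> moment_sphere n A B"
    and max: "\<forall>y\<in>moment_sphere n A B. s * exp_dd n y \<le> s * exp_dd n z"
    and ijk: "i \<le> n" "j \<le> n" "k \<le> n" "i \<noteq> j" "i \<noteq> k" "j \<noteq> k"
    and le: "s * z j \<le> s * z i" "s * z k \<le> s * z i"
  shows "z j = z k"
proof (rule ccontr)
  assume "z j \<noteq> z k"
  from triple_improvement[OF s le this] obtain a b c where
    abc: "a + b + c = z i + z j + z k" "a\<^sup>2 + b\<^sup>2 + c\<^sup>2 = (z i)\<^sup>2 + (z j)\<^sup>2 + (z k)\<^sup>2"
      "s * (z i * z j * z k) < s * (a * b * c)" by blast
  define y where "y = z(i := a, j := b, k := c)"
  have y: "y i = a" "y j = b" "y k = c" "\<And>l. l \<notin> {i, j, k} \<Longrightarrow> y l = z l"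
    using ijk by (auto simp: y_def)
  have sum: "(\<Sum>l\<le>n. f (y l)) = (\<Sum>l\<le>n. f (z l))"
    if "f a + f b + f c = f (z i) + f (z j) + f (z k)" for f :: "real \<Rightarrow> real"
  proof -
    have split: "(\<Sum>l\<le>n. g l) = (\<Sum>l\<in>{..n} - {i, j, k}. g l) + (g i + g j + g k)" for g :: "nat \<Rightarrow> real"
      using sum.subset_diff[of "{i, j, k}" "{..n}" g] ijk by (simp add: add.assoc)
    show ?thesis
      unfolding split[of "\<lambda>l. f (y l)"] split[of "\<lambda>l. f (z l)"] using y that by simp
  qed
  have ys: "y \<in> moment_sphere n A B"
    using z sum[of "\<lambda>t. t"] sum[of "\<lambda>t. t\<^sup>2"] abc y(4) ijk
    by (auto simp: moment_sphere_def)
  have "s * exp_dd n z < s * exp_dd n y"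
    using s
  proof
    assume "s = 1"
    then show ?thesis
      using exp_dd_triple_less[OF ijk, of y z] abc y bspec[OF nonneg ys] bspec[OF nonneg z] by auto
  next
    \<comment> \<open>For minima the old and new nodes exchange roles in
      \<open>exp_dd_triple_less\<close>.\<close>
    assume "s = - 1"
    then show ?thesis
      using exp_dd_triple_less[OF ijk, of z y] abc y bspec[OF nonneg ys] bspec[OF nonneg z] by auto
  qed
  then show False using bspec[OF max ys] by simp
qed

lemma mean_var_iff_moments:
  "mean n y = \<mu> \<and> var n y = v \<longleftrightarrow>
    (\<Sum>i\<le>n. y i) = real (n + 1) * \<mu> \<and> (\<Sum>i\<le>n. (y i)\<^sup>2) = real (n + 1) * (v + \<mu>\<^sup>2)"
proof -
  have "(\<Sum>i\<le>n. (y i - \<mu>)\<^sup>2) = (\<Sum>i\<le>n. (y i)\<^sup>2) - 2 * \<mu> * (\<Sum>i\<le>n. y i) + real (n + 1) * \<mu>\<^sup>2"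
    by (simp add: power2_diff sum.distrib sum_subtractf sum_distrib_left algebra_simps)
  moreover have "mean n y = \<mu> \<longleftrightarrow> (\<Sum>i\<le>n. y i) = real (n + 1) * \<mu>"
    by (auto simp: mean_def field_simps)
  ultimately show ?thesis
    by (auto simp: var_def field_simps power2_eq_square)
qed

lemma mean_var_upper_config:
  assumes "n \<ge> 1"
  shows "mean n (upper_config n \<mu> \<tau>) = \<mu> \<and> var n (upper_config n \<mu> \<tau>) = \<tau>\<^sup>2"
proof -
  define q where "q = sqrt (real n) * \<tau> / real n"
  have nq: "sqrt (real n) * \<tau> = real n * q" using assms by (simp add: q_def)
  have "(real n * q)\<^sup>2 = real n * \<tau>\<^sup>2"
    unfolding nq[symmetric] by (simp add: power_mult_distrib)
  then have q: "real n * q\<^sup>2 = \<tau>\<^sup>2"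
    using assms by (simp add: power2_eq_square mult.left_commute)
  have split: "{..n} = insert 0 {1..n}" by auto
  have sum: "(\<Sum>i\<le>n. f (upper_config n \<mu> \<tau> i)) = f (\<mu> + real n * q) + real n * f (\<mu> - q)"
    for f :: "real \<Rightarrow> real"
    unfolding split by (simp add: upper_config_def Let_def nq)
  show ?thesis
    unfolding mean_var_iff_moments sum[of "\<lambda>x. x"] sum[of "\<lambda>x. x\<^sup>2"] of_nat_add of_nat_1
    using q by algebra
qed

lemma mean_var_permute:
  assumes "p permutes {..n}"
  shows "mean n (y \<circ> p) = mean n y" "var n (y \<circ> p) = var n y"
proof -
  show m: "mean n (y \<circ> p) = mean n y"
    using sum.permute[OF assms, of y] by (simp add: mean_def)
  show "var n (y \<circ> p) = var n y"
    using sum.permute[OF assms, of "\<lambda>i. (y i - mean n y)\<^sup>2"] unfolding var_def m by (simp add: comp_def)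
qed

text \<open>With all nodes but \<open>i0\<close> equal, the two moment equations determine the
  deviation \<open>t\<close> of the exceptional node up to sign, and extremality of that node fixes
  the sign. A transposition then moves it to index 0.\<close>

lemma two_valued_config:
  assumes "n \<ge> 1" and s: "s = 1 \<or> s = - 1" and "\<sigma> \<ge> 0"
    and mv: "mean n z = \<mu>" "var n z = \<sigma>\<^sup>2"
    and "i0 \<le> n" and max: "\<And>i. i \<le> n \<Longrightarrow> s * z i \<le> s * z i0"
    and eq: "\<And>i j. i \<le> n \<Longrightarrow> j \<le> n \<Longrightarrow> i \<noteq> i0 \<Longrightarrow> j \<noteq> i0 \<Longrightarrow> z i = z j"
  obtains p where "p permutes {..n}" "\<And>i. i \<le> n \<Longrightarrow> z i = (upper_config n \<mu> (s * \<sigma>) \<circ> p) i"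
proof -
  define i1 where "i1 = (if i0 = 0 then 1 else 0 :: nat)"
  have i1: "i1 \<le> n" "i1 \<noteq> i0" using assms(1) by (auto simp: i1_def)
  define t a where "t = z i0 - \<mu>" and "a = z i1"
  have a: "z i = a" if "i \<le> n" "i \<noteq> i0" for i
    using eq[of i i1] that i1 by (simp add: a_def)
  have sum: "(\<Sum>i\<le>n. f (z i)) = f (\<mu> + t) + real n * f a" for f :: "real \<Rightarrow> real"
  proof -
    have "(\<Sum>i\<le>n. f (z i)) = f (z i0) + (\<Sum>i\<in>{..n} - {i0}. f (z i))"
      using \<open>i0 \<le> n\<close> by (simp add: sum.remove)
    also have "(\<Sum>i\<in>{..n} - {i0}. f (z i)) = (\<Sum>i\<in>{..n} - {i0}. f a)"
      using a by (intro sum.cong) auto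
    also have "\<dots> = real n * f a"
      using \<open>i0 \<le> n\<close> by simp
    finally show ?thesis by (simp add: t_def)
  qed
  have n: "real n > 0" using assms(1) by simp
  have m1: "\<mu> + t + real n * a = real (n + 1) * \<mu>"
    and m2: "(\<mu> + t)\<^sup>2 + real n * a\<^sup>2 = real (n + 1) * (\<sigma>\<^sup>2 + \<mu>\<^sup>2)"
    using mv mean_var_iff_moments[of n z \<mu> "\<sigma>\<^sup>2"] sum[of "\<lambda>x. x"] sum[of "\<lambda>x. x\<^sup>2"] by auto
  have a_eq: "a = \<mu> - t / real n" using m1 n by (simp add: field_simps)
  \<comment> \<open>Eliminating \<open>a\<close> from the two moment equations leaves an equation
    for \<open>t\<close> alone.\<close>
  have "real (n + 1) * t\<^sup>2 = real (n + 1) * (real n * \<sigma>\<^sup>2)"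
  proof -
    have "real n * a = real n * \<mu> - t" using m1 by (simp add: algebra_simps)
    with m2 show ?thesis unfolding of_nat_add of_nat_1 by algebra
  qed
  then have "(s * t)\<^sup>2 = (sqrt (real n) * \<sigma>)\<^sup>2"
    using s by (auto simp: power_mult_distrib simp del: of_nat_add of_nat_Suc)
  \<comment> \<open>The exceptional node exceeds the others by \<open>t + t / real n\<close>, which
    has the sign of \<open>t\<close>.\<close>
  moreover have "s * t \<ge> 0"
  proof -
    have "s * (t / real n + t) \<ge> 0"
      using max[OF i1(1)] unfolding a_def[symmetric] a_eq t_def by (simp add: algebra_simps)
    moreover have "t / real n + t = t * (1 / real n + 1)" by (simp add: algebra_simps)
    ultimately have "(s * t) * (1 / real n + 1) \<ge> 0" by (simp add: mult.assoc)
    moreover have "1 / real n + 1 > 0" by (simp add: add_nonneg_pos)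
    ultimately show ?thesis
      using mult_right_le_imp_le[of 0 "1 / real n + 1" "s * t"] by simp
  qed
  ultimately have "s * t = sqrt (real n) * \<sigma>"
    using \<open>\<sigma> \<ge> 0\<close> by (simp add: power2_eq_iff_nonneg)
  then have t: "t = sqrt (real n) * (s * \<sigma>)" using s by auto
  show thesis
  proof (rule that)
    show "Transposition.transpose 0 i0 permutes {..n}"
      using \<open>i0 \<le> n\<close> by (simp add: permutes_swap_id)
    show "z i = (upper_config n \<mu> (s * \<sigma>) \<circ> Transposition.transpose 0 i0) i" if "i \<le> n" for i
    proof (cases "i = i0")
      case True
      then show ?thesis by (simp add: upper_config_def Let_def t_def flip: t)
    next
      case False
      then have "Transposition.transpose 0 i0 i \<noteq> 0" by (auto simp: Transposition.transpose_def)
      then show ?thesis using a[OF that False] by (simp add: upper_config_def Let_def a_eq flip: t)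
    qed
  qed
qed

text \<open>An extremum exists by compactness, and its shape is forced by
  \<open>exp_dd_maximizer_two_values\<close> and \<open>two_valued_config\<close>.\<close>

lemma exp_dd_extremal_nonneg:
  assumes "n \<ge> 1" and s: "s = 1 \<or> s = - 1" and "\<sigma> \<ge> 0"
    and x: "mean n x = \<mu>" "var n x = \<sigma>\<^sup>2"
    and nonneg: "\<And>y i. mean n y = \<mu> \<Longrightarrow> var n y = \<sigma>\<^sup>2 \<Longrightarrow> i \<le> n \<Longrightarrow> y i \<ge> 0"
  shows "s * exp_dd n x \<le> s * exp_dd n (upper_config n \<mu> (s * \<sigma>))"
proof -
  define S where "S = moment_sphere n (real (n + 1) * \<mu>) (real (n + 1) * (\<sigma>\<^sup>2 + \<mu>\<^sup>2))"
  have S: "y \<in> S \<longleftrightarrow> (mean n y = \<mu> \<and> var n y = \<sigma>\<^sup>2) \<and> (\<forall>i. i > n \<longrightarrow> y i = 0)" for y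
    unfolding S_def moment_sphere_def mean_var_iff_moments by auto
  \<comment> \<open>Clearing the coordinates beyond \<open>n\<close> places the nodes in the compact
    set without affecting \<open>exp_dd\<close>.\<close>
  define x0 where "x0 i = (if i \<le> n then x i else 0)" for i
  have "x0 \<in> S"
    using mean_var_iff_moments[THEN iffD1, OF conjI[OF x]]
    by (simp add: S_def moment_sphere_def x0_def)
  moreover have "compact S" unfolding S_def by (rule compact_moment_sphere)
  moreover have "continuous_on S (\<lambda>y. s * exp_dd n y)"
    by (intro continuous_intros continuous_on_exp_dd)
  ultimately obtain z where z: "z \<in> S" "\<forall>y\<in>S. s * exp_dd n y \<le> s * exp_dd n z"
    using continuous_attains_sup[of S "\<lambda>y. s * exp_dd n y"] by blast
  have "\<exists>i0\<in>{..n}. \<forall>i\<in>{..n}. s * z i \<le> s * z i0"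
    using continuous_attains_sup[of "{..n}" "\<lambda>i. s * z i"] by (auto simp: finite_imp_compact)
  then obtain i0 where i0: "i0 \<le> n" "\<And>i. i \<le> n \<Longrightarrow> s * z i \<le> s * z i0" by auto
  have nonneg': "\<forall>y\<in>S. \<forall>i\<le>n. y i \<ge> 0"
    using nonneg by (simp add: S)
  have eq: "z i = z j" if "i \<le> n" "j \<le> n" "i \<noteq> i0" "j \<noteq> i0" for i j
  proof (cases "i = j")
    case False
    have "s * z i \<le> s * z i0" "s * z j \<le> s * z i0" using i0 that by auto
    with False that i0(1) show ?thesis
      by (intro exp_dd_maximizer_two_values[OF s nonneg'[unfolded S_def] z[unfolded S_def] i0(1)]) auto
  qed simp
  have mv: "mean n z = \<mu>" "var n z = \<sigma>\<^sup>2" using z(1) by (simp_all add: S)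
  obtain p where p: "p permutes {..n}" "\<And>i. i \<le> n \<Longrightarrow> z i = (upper_config n \<mu> (s * \<sigma>) \<circ> p) i"
    using two_valued_config[where n = n and z = z and ?i0.0 = i0, OF assms(1) s assms(3) mv i0 eq]
    by blast
  have "exp_dd n x = exp_dd n x0" by (rule exp_dd_cong) (simp add: x0_def)
  then have "s * exp_dd n x \<le> s * exp_dd n z" using z \<open>x0 \<in> S\<close> by simp
  also have "exp_dd n z = exp_dd n (upper_config n \<mu> (s * \<sigma>))"
    using exp_dd_cong[where x = z, OF p(2)] exp_dd_permute[OF p(1)] by metis
  finally show ?thesis .
qed

lemma mean_var_shift: "mean n (\<lambda>i. x i + c) = mean n x + c" "var n (\<lambda>i. x i + c) = var n x"
proof -
  show m: "mean n (\<lambda>i. x i + c) = mean n x + c"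
    by (simp add: mean_def sum.distrib field_simps)
  show "var n (\<lambda>i. x i + c) = var n x" by (simp add: var_def m)
qed

text \<open>Translation multiplies both sides by the same positive factor, so the mean may be raised
  until nonnegativity is automatic.\<close>

lemma exp_dd_extremal:
  assumes "n \<ge> 1" and s: "s = 1 \<or> s = - 1" and "\<sigma> \<ge> 0" and x: "mean n x = \<mu>" "var n x = \<sigma>\<^sup>2"
  shows "s * exp_dd n x \<le> s * exp_dd n (upper_config n \<mu> (s * \<sigma>))"
proof -
  \<comment> \<open>The square of \<open>r\<close> is the total of the squared deviations, so no
    node deviates from the mean by more than \<open>r\<close>; mean \<open>r\<close> therefore makes
    all nodes nonnegative.\<close>
  define r where "r = sqrt (real (n + 1)) * \<sigma>"
  define c where "c = r - \<mu>"
  have "s * exp_dd n (\<lambda>i. x i + c) \<le> s * exp_dd n (upper_config n r (s * \<sigma>))"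
  proof (rule exp_dd_extremal_nonneg[OF assms(1-3)])
    show "y i \<ge> 0" if "mean n y = r" "var n y = \<sigma>\<^sup>2" "i \<le> n" for y i
    proof -
      have "(y i - r)\<^sup>2 \<le> (\<Sum>i\<le>n. (y i - r)\<^sup>2)"
        using that by (intro member_le_sum) auto
      also have "\<dots> = r\<^sup>2"
        using that by (simp add: var_def r_def power_mult_distrib field_simps)
      finally have "\<bar>y i - r\<bar> \<le> \<bar>r\<bar>" by (simp add: abs_le_square_iff)
      moreover have "r \<ge> 0" using assms(3) by (simp add: r_def)
      ultimately show ?thesis by simp
    qed
  qed (use x in \<open>simp_all add: mean_var_shift c_def\<close>)
  also have "upper_config n r (s * \<sigma>) = (\<lambda>i. upper_config n \<mu> (s * \<sigma>) i + c)"
    by (auto simp: upper_config_def Let_def c_def)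
  finally have "exp c * (s * exp_dd n x) \<le> exp c * (s * exp_dd n (upper_config n \<mu> (s * \<sigma>)))"
    by (simp add: exp_dd_shift[OF assms(1)] mult.left_commute)
  then show ?thesis by simp
qed

text \<open>Negating \<open>\<sigma>\<close> negates both \<open>a0\<close> and \<open>a\<close>, so
  the lower bound needs no separate evaluation.\<close>

lemma L_bound_eq: "L_bound n \<sigma> = M_bound n (- \<sigma>)"
  by (simp add: L_bound_def M_bound_def Let_def)

lemma lower_config_eq: "lower_config n \<mu> \<sigma> = upper_config n \<mu> (- \<sigma>)"
  by (simp add: lower_config_def upper_config_def Let_def fun_eq_iff)

theorem theorem4:
  fixes n :: nat and x :: "nat \<Rightarrow> real" and \<mu> \<sigma> :: real
  assumes "n \<ge> 1"
    and "\<mu> = mean n x"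
    and "\<sigma> \<ge> 0" and "\<sigma>\<^sup>2 = var n x"
  shows "exp \<mu> * L_bound n \<sigma> \<le> fact n * divdiff exp n x
    \<and> fact n * divdiff exp n x \<le> exp \<mu> * M_bound n \<sigma>
    \<and> (\<forall>p y. p permutes {..n} \<and> y = upper_config n \<mu> \<sigma> \<circ> p \<longrightarrow>
          mean n y = \<mu> \<and> var n y = \<sigma>\<^sup>2
          \<and> fact n * divdiff exp n y = exp \<mu> * M_bound n \<sigma>)
    \<and> (\<forall>p y. p permutes {..n} \<and> y = lower_config n \<mu> \<sigma> \<circ> p \<longrightarrow>
          mean n y = \<mu> \<and> var n y = \<sigma>\<^sup>2
          \<and> exp \<mu> * L_bound n \<sigma> = fact n * divdiff exp n y)"
proof -
  have config: "mean n (upper_config n \<mu> \<tau> \<circ> p) = \<mu> \<and> var n (upper_config n \<mu> \<tau> \<circ> p) = \<tau>\<^sup>2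
      \<and> fact n * divdiff exp n (upper_config n \<mu> \<tau> \<circ> p) = exp \<mu> * M_bound n \<tau>"
    if "p permutes {..n}" for p \<tau>
    using that assms(1)
    by (simp add: mean_var_permute mean_var_upper_config divdiff_exp exp_dd_permute exp_dd_upper_config)
  \<comment> \<open>The choice \<open>s = 1\<close> gives the upper bound; \<open>s = - 1\<close>
    reverses the inequality and gives the lower one.\<close>
  have bound: "s * (fact n * divdiff exp n x) \<le> s * (exp \<mu> * M_bound n (s * \<sigma>))"
    if "s = 1 \<or> s = - 1" for s :: real
  proof -
    have "fact n * (s * exp_dd n x) \<le> fact n * (s * exp_dd n (upper_config n \<mu> (s * \<sigma>)))"
      by (rule mult_left_mono[OF exp_dd_extremal]) (use assms that in auto)
    then show ?thesis
      using assms(1) by (simp add: divdiff_exp mult.left_commute flip: exp_dd_upper_config)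
  qed
  show ?thesis
    using bound[of 1] bound[of "- 1"] config[of _ \<sigma>] config[of _ "- \<sigma>"]
    by (auto simp: L_bound_eq lower_config_eq)
qed

end
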